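(* The statistic $\mathrm{Stat}_{123}(\sigma)=\mathrm{inv}(\sigma)-\mathrm{inv}(\Phi_{321}(\sigma))$ on permutations exhibits the cyclic sieving phenomenon under involutions with $1$ fixed point when $n=0$ and $2^{n-1}$ fixed points for all $n\ge1$.
   Context: $\mathfrak{S}_n$ is the set of permutations $\sigma=\sigma_1\cdots\sigma_n$ of $[n]$; $\mathrm{inv}(\sigma)=\#\{(i,j):i<j,\ \sigma_i>\sigma_j\}$. A position $i$ is a left-to-right maximum if $\sigma_i>\sigma_j$ for all $j<i$. The Simion–Schmidt map $\Phi_{321}$ keeps the entries at positions of left-to-right maxima fixed and places the remaining entries in increasing order into the remaining positions. Cyclic sieving for involutions: for an involution $\phi$ on a finite set $X$ and polynomial $f$, $(X,\{\mathrm{id},\phi\},f)$ exhibits the CSP iff $f(1)=|X|$ and $f(-1)$ equals the number of fixed points of $\phi$. A statistic exhibits the CSP under involutions with $a_n$ fixed points if for every $n\ge0$ and every involution $\phi$ of $\mathfrak{S}_n$ with exactly $a_n$ fixed points, $(\mathfrak{S}_n,\{\mathrm{id},\phi\},\sum_{\sigma\in\mathfrak{S}_n}q^{\mathrm{stat}(\sigma)})$ exhibits the CSP. *)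

theory Defs
  imports
    "HOL-Combinatorics.Multiset_Permutations"
    "HOL-Computational_Algebra.Polynomial"
    "HOL-Library.FuncSet"
begin

text \<open>
  A permutation is written in one-line notation as a list, with positions counted from \<open>0\<close>;
  \<open>\<SS>\<^sub>n\<close> is the set of lists enumerating \<open>{1..n}\<close> without repetition.
\<close>

abbreviation Sym :: "nat \<Rightarrow> nat list set" where
  "Sym n \<equiv> permutations_of_set {1..n}"

definition inversions :: "nat list \<Rightarrow> (nat \<times> nat) set" where
  "inversions w = {(i, j). i < j \<and> j < length w \<and> w ! i > w ! j}"

definition inv_stat :: "nat list \<Rightarrow> nat" where
  "inv_stat w = card (inversions w)"

definition ltr_max :: "nat list \<Rightarrow> nat set" where
  "ltr_max w = {i. i < length w \<and> (\<forall>j<i. w ! i > w ! j)}"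

definition non_ltr_max :: "nat list \<Rightarrow> nat set" where
  "non_ltr_max w = {..<length w} - ltr_max w"

text \<open>
  If exactly \<open>k\<close> of the remaining positions precede the remaining position \<open>i\<close>,
  then \<open>i\<close> receives the \<open>(k+1)\<close>-st smallest of the remaining entries.
\<close>

definition Phi321 :: "nat list \<Rightarrow> nat list" where
  "Phi321 w = map (\<lambda>i. if i \<in> ltr_max w then w ! i
      else sorted_list_of_set ((\<lambda>j. w ! j) ` non_ltr_max w) ! card {j \<in> non_ltr_max w. j < i})
    [0..<length w]"

text \<open>
  The subtraction on naturals does not truncate on permutations: see \<open>Stat123_no_truncation\<close>.
\<close>

definition Stat123 :: "nat list \<Rightarrow> nat" where
  "Stat123 w = inv_stat w - inv_stat (Phi321 w)"

definition involution_on :: "'a set \<Rightarrow> ('a \<Rightarrow> 'a) \<Rightarrow> bool" where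
  "involution_on X \<phi> \<longleftrightarrow> \<phi> \<in> X \<rightarrow> X \<and> (\<forall>x\<in>X. \<phi> (\<phi> x) = x)"

definition fixed_points :: "'a set \<Rightarrow> ('a \<Rightarrow> 'a) \<Rightarrow> 'a set" where
  "fixed_points X \<phi> = {x \<in> X. \<phi> x = x}"

definition exhibits_CSP :: "'a set \<Rightarrow> ('a \<Rightarrow> 'a) \<Rightarrow> int poly \<Rightarrow> bool" where
  "exhibits_CSP X \<phi> f \<longleftrightarrow>
     finite X \<and> involution_on X \<phi> \<and>
     poly f 1 = int (card X) \<and> poly f (- 1) = int (card (fixed_points X \<phi>))"

definition generating_poly :: "(nat list \<Rightarrow> nat) \<Rightarrow> nat \<Rightarrow> int poly" where
  "generating_poly stat n = (\<Sum>\<sigma>\<in>Sym n. monom 1 (stat \<sigma>))"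

definition stat_exhibits_CSP :: "(nat list \<Rightarrow> nat) \<Rightarrow> (nat \<Rightarrow> nat) \<Rightarrow> bool" where
  "stat_exhibits_CSP stat a \<longleftrightarrow>
     (\<forall>n \<phi>. involution_on (Sym n) \<phi> \<and> card (fixed_points (Sym n) \<phi>) = a n \<longrightarrow>
        exhibits_CSP (Sym n) \<phi> (generating_poly stat n))"

lemma finite_non_ltr_max [simp]: "finite (non_ltr_max w)"
  and finite_ltr_max [simp]: "finite (ltr_max w)"
  by (auto simp: non_ltr_max_def ltr_max_def)

lemma finite_inversions [simp]: "finite (inversions w)"
  by (rule finite_subset[of _ "{..<length w} \<times> {..<length w}"]) (auto simp: inversions_def)

lemma length_Phi321 [simp]: "length (Phi321 w) = length w"
  by (simp add: Phi321_def)

lemma Phi321_nth_ltr_max: "i \<in> ltr_max w \<Longrightarrow> Phi321 w ! i = w ! i"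
  by (simp add: Phi321_def ltr_max_def)

lemma card_below_less:
  assumes "i \<in> N" "i < j" "finite (N :: nat set)"
  shows "card {k \<in> N. k < i} < card {k \<in> N. k < j}"
proof (rule psubset_card_mono)
  show "finite {k \<in> N. k < j}" using assms by simp
  show "{k \<in> N. k < i} \<subset> {k \<in> N. k < j}" using assms by auto
qed

lemma card_below_bound:
  assumes "i \<in> N" "finite (N :: nat set)"
  shows "card {k \<in> N. k < i} < card N"
  by (rule psubset_card_mono) (use assms in auto)

context
  fixes w :: "nat list"
  assumes dist: "distinct w"
begin

lemma inj_nth_non_ltr_max: "inj_on (\<lambda>j. w ! j) (non_ltr_max w)"
  using dist by (auto simp: inj_on_def non_ltr_max_def nth_eq_iff_index_eq)

lemma Phi321_nth_non_ltr_max: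
  assumes "i \<in> non_ltr_max w"
  shows "Phi321 w ! i = sorted_list_of_set ((\<lambda>j. w ! j) ` non_ltr_max w) !
    card {j \<in> non_ltr_max w. j < i}"
  using assms by (simp add: Phi321_def non_ltr_max_def)

lemma Phi321_mono_non_ltr_max:
  assumes "i \<in> non_ltr_max w" "j \<in> non_ltr_max w" "i < j"
  shows "Phi321 w ! i < Phi321 w ! j"
proof -
  let ?N = "non_ltr_max w"
  let ?s = "sorted_list_of_set ((\<lambda>j. w ! j) ` ?N)"
  have len: "length ?s = card ?N" by (simp add: card_image inj_nth_non_ltr_max)
  have "sorted_wrt (<) ?s" by simp
  moreover have "card {k \<in> ?N. k < i} < card {k \<in> ?N. k < j}"
    using assms by (intro card_below_less) auto
  moreover have "card {k \<in> ?N. k < j} < length ?s"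
    unfolding len using assms by (intro card_below_bound) auto
  ultimately have "?s ! card {k \<in> ?N. k < i} < ?s ! card {k \<in> ?N. k < j}"
    by (simp only: sorted_wrt_nth_less)
  then show ?thesis using assms by (simp add: Phi321_nth_non_ltr_max)
qed

lemma inj_Phi321_non_ltr_max: "inj_on (\<lambda>j. Phi321 w ! j) (non_ltr_max w)"
  by (rule inj_onI) (metis Phi321_mono_non_ltr_max nat_neq_iff)

lemma Phi321_image_non_ltr_max:
  "(\<lambda>j. Phi321 w ! j) ` non_ltr_max w = (\<lambda>j. w ! j) ` non_ltr_max w"
proof (rule card_subset_eq)
  let ?N = "non_ltr_max w"
  let ?s = "sorted_list_of_set ((\<lambda>j. w ! j) ` ?N)"
  have len: "length ?s = card ?N" by (simp add: card_image inj_nth_non_ltr_max)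
  show "(\<lambda>j. Phi321 w ! j) ` ?N \<subseteq> (\<lambda>j. w ! j) ` ?N"
  proof (rule image_subsetI)
    fix i assume i: "i \<in> ?N"
    have "card {k \<in> ?N. k < i} < length ?s"
      unfolding len using i by (intro card_below_bound) auto
    then have "?s ! card {k \<in> ?N. k < i} \<in> set ?s" by (rule nth_mem)
    then show "Phi321 w ! i \<in> (\<lambda>j. w ! j) ` ?N"
      using i by (simp add: Phi321_nth_non_ltr_max)
  qed
qed (simp_all add: card_image inj_Phi321_non_ltr_max inj_nth_non_ltr_max)

lemma card_values_less:
  "card {j \<in> non_ltr_max w. Phi321 w ! j < t} = card {j \<in> non_ltr_max w. w ! j < t}"
proof -
  let ?N = "non_ltr_max w"
  have "card {j \<in> ?N. Phi321 w ! j < t} = card ((\<lambda>j. Phi321 w ! j) ` {j \<in> ?N. Phi321 w ! j < t})"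
    by (rule card_image[symmetric]) (rule inj_on_subset[OF inj_Phi321_non_ltr_max], auto)
  also have "(\<lambda>j. Phi321 w ! j) ` {j \<in> ?N. Phi321 w ! j < t} =
      {x \<in> (\<lambda>j. Phi321 w ! j) ` ?N. x < t}" by auto
  also have "\<dots> = {x \<in> (\<lambda>j. w ! j) ` ?N. x < t}"
    by (simp only: Phi321_image_non_ltr_max)
  also have "\<dots> = (\<lambda>j. w ! j) ` {j \<in> ?N. w ! j < t}" by auto
  also have "card \<dots> = card {j \<in> ?N. w ! j < t}"
    by (rule card_image) (rule inj_on_subset[OF inj_nth_non_ltr_max], auto)
  finally show ?thesis .
qed

lemma Phi321_less_ltr_max:
  assumes i: "i \<in> ltr_max w" and j: "j \<in> non_ltr_max w" "j < i"
  shows "Phi321 w ! j < w ! i"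
proof (rule ccontr)
  let ?N = "non_ltr_max w"
  assume neg: "\<not> Phi321 w ! j < w ! i"
  have "card {k \<in> ?N. k < i} \<le> card {k \<in> ?N. w ! k < w ! i}"
    using i by (intro card_mono) (auto simp: ltr_max_def)
  also have "\<dots> = card {k \<in> ?N. Phi321 w ! k < w ! i}" by (rule card_values_less[symmetric])
  also have "\<dots> \<le> card {k \<in> ?N. k < j}"
  proof (rule card_mono)
    show "{k \<in> ?N. Phi321 w ! k < w ! i} \<subseteq> {k \<in> ?N. k < j}"
    proof safe
      fix k assume k: "k \<in> ?N" "Phi321 w ! k < w ! i"
      then have "k \<noteq> j" using neg by auto
      moreover have "\<not> j < k"
        using k neg Phi321_mono_non_ltr_max[OF j(1) k(1)] by linarith
      ultimately show "k < j" by simp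
    qed
  qed simp
  finally show False using card_below_less[of j ?N i] j by simp
qed

lemma card_inversions_from_ltr_max:
  assumes i: "i \<in> ltr_max w"
  shows "card {j \<in> non_ltr_max w. i < j \<and> Phi321 w ! j < w ! i} =
         card {j \<in> non_ltr_max w. i < j \<and> w ! j < w ! i}"
proof -
  let ?N = "non_ltr_max w"
  have split: "card {j \<in> ?N. v ! j < w ! i} =
      card {j \<in> ?N. j < i} + card {j \<in> ?N. i < j \<and> v ! j < w ! i}"
    if "\<And>j. j \<in> ?N \<Longrightarrow> j < i \<Longrightarrow> v ! j < w ! i" for v :: "nat list"
  proof -
    have "j < i \<or> i < j" if "j \<in> ?N" for j
      using i that by (cases i j rule: linorder_cases) (auto simp: non_ltr_max_def)
    then have eq: "{j \<in> ?N. v ! j < w ! i} =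
        {j \<in> ?N. j < i} \<union> {j \<in> ?N. i < j \<and> v ! j < w ! i}"
      using that by blast
    show ?thesis unfolding eq by (rule card_Un_disjoint) auto
  qed
  have "card {j \<in> ?N. w ! j < w ! i} =
      card {j \<in> ?N. j < i} + card {j \<in> ?N. i < j \<and> w ! j < w ! i}"
    by (rule split) (use i in \<open>auto simp: ltr_max_def\<close>)
  moreover have "card {j \<in> ?N. Phi321 w ! j < w ! i} =
      card {j \<in> ?N. j < i} + card {j \<in> ?N. i < j \<and> Phi321 w ! j < w ! i}"
    by (rule split) (use i in \<open>auto intro: Phi321_less_ltr_max\<close>)
  ultimately show ?thesis by (simp add: card_values_less)
qed

lemma inversions_Phi321:
  "inversions (Phi321 w) =
     (SIGMA i:ltr_max w. {j \<in> non_ltr_max w. i < j \<and> Phi321 w ! j < w ! i})"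
proof (intro equalityI subsetI)
  fix p assume "p \<in> inversions (Phi321 w)"
  then obtain i j where p: "p = (i, j)" "i < j" "j < length w" "Phi321 w ! j < Phi321 w ! i"
    by (auto simp: inversions_def)
  have i_cases: "i \<in> ltr_max w \<or> i \<in> non_ltr_max w" using p by (auto simp: non_ltr_max_def)
  have "j \<notin> ltr_max w"
  proof
    assume j: "j \<in> ltr_max w"
    from i_cases have "Phi321 w ! i < w ! j"
    proof
      assume "i \<in> ltr_max w"
      moreover have "w ! i < w ! j" using j p by (simp add: ltr_max_def)
      ultimately show ?thesis by (simp add: Phi321_nth_ltr_max)
    next
      assume "i \<in> non_ltr_max w"
      then show ?thesis using j p by (intro Phi321_less_ltr_max)
    qed
    then show False using p j by (simp add: Phi321_nth_ltr_max)
  qed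
  then have j: "j \<in> non_ltr_max w" using p by (auto simp: non_ltr_max_def)
  have i: "i \<in> ltr_max w" using i_cases j p Phi321_mono_non_ltr_max[of i j] by auto
  show "p \<in> (SIGMA i:ltr_max w. {j \<in> non_ltr_max w. i < j \<and> Phi321 w ! j < w ! i})"
    using p i j by (simp add: Phi321_nth_ltr_max)
qed (auto simp: inversions_def non_ltr_max_def Phi321_nth_ltr_max)

lemma inv_stat_Phi321_le: "inv_stat (Phi321 w) \<le> inv_stat w"
proof -
  let ?N = "non_ltr_max w"
  have "inv_stat (Phi321 w) = (\<Sum>i\<in>ltr_max w. card {j \<in> ?N. i < j \<and> Phi321 w ! j < w ! i})"
    unfolding inv_stat_def inversions_Phi321 by (rule card_SigmaI) auto
  also have "\<dots> = (\<Sum>i\<in>ltr_max w. card {j \<in> ?N. i < j \<and> w ! j < w ! i})"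
    by (intro sum.cong refl card_inversions_from_ltr_max)
  also have "\<dots> = card (SIGMA i:ltr_max w. {j \<in> ?N. i < j \<and> w ! j < w ! i})"
    by (rule card_SigmaI[symmetric]) auto
  also have "\<dots> \<le> inv_stat w"
    unfolding inv_stat_def
    by (rule card_mono[OF finite_inversions]) (auto simp: inversions_def non_ltr_max_def)
  finally show ?thesis .
qed

end

lemma Stat123_no_truncation:
  assumes "\<sigma> \<in> Sym n"
  shows "int (Stat123 \<sigma>) = int (inv_stat \<sigma>) - int (inv_stat (Phi321 \<sigma>))"
  using inv_stat_Phi321_le[of \<sigma>] assms
  by (simp add: Stat123_def permutations_of_set_def)

end

theory Submission
  imports Defs
begin

text \<open>
  The inversions of \<open>Phi321 \<sigma>\<close> are equinumerous with the inversions of \<open>\<sigma>\<close> starting at a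
  left-to-right maximum, so \<open>Stat123 \<sigma>\<close> counts the inversions starting at any other position.
  Write \<open>e\<^sub>p\<close> for the number of the first \<open>p\<close> positions that are not left-to-right maxima.
  Inserting a new smallest letter after the first \<open>p\<close> letters raises the statistic by \<open>e\<^sub>p\<close>
  and, for \<open>p > 0\<close>, does not affect which of the old letters are left-to-right maxima.
  Put \<open>s\<^sub>p = (-1) ^ e\<^sub>p\<close> and let \<open>A\<^sub>n\<close> and \<open>B\<^sub>n\<close> be the signed sums over \<open>\<SS>\<^sub>n\<close> of \<open>1\<close> and of
  \<open>s\<^sub>1 + \<dots> + s\<^sub>n\<close>. Then \<open>A\<^sub>n\<^sub>+\<^sub>1 = A\<^sub>n + B\<^sub>n\<close>. For \<open>B\<^sub>n\<^sub>+\<^sub>1\<close>, insertion at the front contributes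
  \<open>A\<^sub>n + B\<^sub>n\<close>, while the insertions at \<open>p > 0\<close> contribute sums of
  \<open>s\<^sub>p s\<^sub>q ([q \<le> p] - [p \<le> q])\<close>, which cancel by antisymmetry.
  Hence \<open>A\<^sub>n = B\<^sub>n = 2 ^ (n - 1)\<close> for \<open>n \<ge> 1\<close>.
\<close>

section \<open>Recursive form of the statistic\<close>

text \<open>
  The argument \<open>m\<close> is the maximum of the letters already read; reading starts with \<open>m = 0\<close>, so
  all letters have to be positive.
\<close>

fun non_max_count :: "nat \<Rightarrow> nat list \<Rightarrow> nat" where
  "non_max_count m [] = 0"
| "non_max_count m (x # xs) =
     (if m < x then non_max_count x xs else Suc (non_max_count m xs))"

fun non_max_inv :: "nat \<Rightarrow> nat list \<Rightarrow> nat" where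
  "non_max_inv m [] = 0"
| "non_max_inv m (x # xs) =
     (if m < x then non_max_inv x xs
      else length (filter (\<lambda>y. y < x) xs) + non_max_inv m xs)"

lemma card_later_smaller_Cons:
  "card {j. 0 < j \<and> j < Suc (length xs) \<and> (x # xs) ! j < x} = length (filter (\<lambda>y. y < x) xs)"
proof -
  have "{j. 0 < j \<and> j < Suc (length xs) \<and> (x # xs) ! j < x} =
      Suc ` {j. j < length xs \<and> xs ! j < x}"
    by (auto simp: image_iff gr0_conv_Suc)
  then show ?thesis by (simp add: card_image length_filter_conv_card)
qed

lemma card_later_smaller_Cons_Suc:
  "card {j. Suc i < j \<and> j < Suc (length xs) \<and> (x # xs) ! j < xs ! i} =
   card {j. i < j \<and> j < length xs \<and> xs ! j < xs ! i}"
proof -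
  have "{j. Suc i < j \<and> j < Suc (length xs) \<and> (x # xs) ! j < xs ! i} =
      Suc ` {j. i < j \<and> j < length xs \<and> xs ! j < xs ! i}"
    by (auto simp: image_iff Suc_less_eq2)
  then show ?thesis by (simp add: card_image)
qed

text \<open>After \<open>x\<close> is read, exceeding \<open>m\<close> and all letters so far is
  again a test against one threshold: \<open>x\<close> if \<open>m < x\<close>, otherwise
  \<open>m\<close>. The threshold is arbitrary because the induction changes it.\<close>

lemma non_max_inv_eq_sum:
  "non_max_inv m w =
     (\<Sum>i<length w. if m < w ! i \<and> (\<forall>k<i. w ! k < w ! i) then 0
        else card {j. i < j \<and> j < length w \<and> w ! j < w ! i})"
proof (induction w arbitrary: m)
  case (Cons x xs)
  show ?case
  proof (cases "m < x")
    case True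
    then have "(m < xs ! i \<and> (\<forall>k<Suc i. (x # xs) ! k < xs ! i)) \<longleftrightarrow>
        x < xs ! i \<and> (\<forall>k<i. xs ! k < xs ! i)" for i
      by (auto simp: All_less_Suc2)
    with True show ?thesis
      by (simp add: sum.lessThan_Suc_shift Cons.IH[of x] card_later_smaller_Cons_Suc
          cong: if_cong del: sum.lessThan_Suc)
  next
    case False
    then have "(m < xs ! i \<and> (\<forall>k<Suc i. (x # xs) ! k < xs ! i)) \<longleftrightarrow>
        m < xs ! i \<and> (\<forall>k<i. xs ! k < xs ! i)" for i
      by (auto simp: All_less_Suc2)
    with False show ?thesis
      by (simp add: sum.lessThan_Suc_shift Cons.IH[of m] card_later_smaller_Cons_Suc
          card_later_smaller_Cons cong: if_cong del: sum.lessThan_Suc)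
  qed
qed simp

lemma inv_stat_eq_sum:
  "inv_stat w = (\<Sum>i<length w. card {j. i < j \<and> j < length w \<and> w ! j < w ! i})"
proof -
  have "inversions w = (SIGMA i:{..<length w}. {j. i < j \<and> j < length w \<and> w ! j < w ! i})"
    by (auto simp: inversions_def)
  then show ?thesis by (simp add: inv_stat_def)
qed

text \<open>All inversions of \<open>Phi321 w\<close> start at left-to-right maxima of
  \<open>w\<close>, and each of these keeps its number of inversions. A smaller letter behind one is
  never itself a left-to-right maximum.\<close>

lemma inv_stat_Phi321_eq_sum:
  assumes "distinct w"
  shows "inv_stat (Phi321 w) =
    (\<Sum>i\<in>ltr_max w. card {j. i < j \<and> j < length w \<and> w ! j < w ! i})"
proof -
  have "inv_stat (Phi321 w) =
      (\<Sum>i\<in>ltr_max w. card {j \<in> non_ltr_max w. i < j \<and> Phi321 w ! j < w ! i})"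
    unfolding inv_stat_def inversions_Phi321[OF assms] by (rule card_SigmaI) auto
  also have "\<dots> = (\<Sum>i\<in>ltr_max w. card {j. i < j \<and> j < length w \<and> w ! j < w ! i})"
  proof (rule sum.cong)
    fix i assume "i \<in> ltr_max w"
    then have "card {j \<in> non_ltr_max w. i < j \<and> Phi321 w ! j < w ! i} =
        card {j \<in> non_ltr_max w. i < j \<and> w ! j < w ! i}"
      by (rule card_inversions_from_ltr_max[OF assms])
    also have "{j \<in> non_ltr_max w. i < j \<and> w ! j < w ! i} =
        {j. i < j \<and> j < length w \<and> w ! j < w ! i}"
      by (auto simp: non_ltr_max_def ltr_max_def)
    finally show "card {j \<in> non_ltr_max w. i < j \<and> Phi321 w ! j < w ! i} =
        card {j. i < j \<and> j < length w \<and> w ! j < w ! i}" .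
  qed simp
  finally show ?thesis .
qed

lemma Stat123_eq_non_max_inv:
  assumes "distinct w" and pos: "\<And>x. x \<in> set w \<Longrightarrow> 0 < x"
  shows "Stat123 w = non_max_inv 0 w"
proof -
  let ?c = "\<lambda>i. card {j. i < j \<and> j < length w \<and> w ! j < w ! i}"
  have sub: "ltr_max w \<subseteq> {..<length w}" by (auto simp: ltr_max_def)
  have "inv_stat w = inv_stat (Phi321 w) + (\<Sum>i\<in>{..<length w} - ltr_max w. ?c i)"
    unfolding inv_stat_eq_sum[of w] inv_stat_Phi321_eq_sum[OF assms(1)]
    using sum.subset_diff[OF sub, of ?c] by simp
  \<comment> \<open>Since all letters are positive, the threshold \<open>0\<close> excludes none of
    them, so the summands set to zero are exactly those at left-to-right maxima.\<close>
  moreover have "(\<Sum>i\<in>{..<length w} - ltr_max w. ?c i) = non_max_inv 0 w"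
    unfolding non_max_inv_eq_sum using pos
    by (intro sum.mono_neutral_cong_left) (auto simp: ltr_max_def)
  ultimately show ?thesis by (simp add: Stat123_def)
qed

section \<open>Insertion of a new smallest letter\<close>

text \<open>The first letter of \<open>v\<close> exceeds both thresholds and then replaces
  them.\<close>

lemma non_max_inv_start:
  assumes "\<And>x. x \<in> set v \<Longrightarrow> a < x"
  shows "non_max_inv a v = non_max_inv 0 v"
  using assms by (cases v) (auto dest: order.strict_trans1[OF le0])

lemma non_max_count_start:
  assumes "\<And>x. x \<in> set v \<Longrightarrow> a < x"
  shows "non_max_count a v = non_max_count 0 v"
  using assms by (cases v) (auto dest: order.strict_trans1[OF le0])

text \<open>Each non-maximum in \<open>u\<close> gains one inversion, with \<open>a\<close>. As
  \<open>a \<le> m\<close>, reading \<open>a\<close> leaves the threshold alone, and no smaller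
  letter follows it.\<close>

lemma non_max_inv_insert_min:
  assumes "a \<le> m" "\<And>x. x \<in> set (u @ v) \<Longrightarrow> a < x"
  shows "non_max_inv m (u @ a # v) = non_max_inv m (u @ v) + non_max_count m u"
  using assms
proof (induction u arbitrary: m)
  case Nil
  then have "filter (\<lambda>y. y < a) v = []" by (fastforce simp: filter_empty_conv)
  with Nil show ?case by simp
qed auto

lemma non_max_count_insert_min:
  assumes "a \<le> m" "\<And>x. x \<in> set u \<Longrightarrow> a < x"
  shows "non_max_count m (u @ a # v) = Suc (non_max_count m (u @ v))"
  using assms by (induction u arbitrary: m) auto

definition insert_at :: "'a \<Rightarrow> nat \<Rightarrow> 'a list \<Rightarrow> 'a list" where
  "insert_at a p w = take p w @ a # drop p w"

text \<open>The sign written \<open>s\<^sub>p\<close> in the overview.\<close>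

definition prefix_sign :: "nat list \<Rightarrow> nat \<Rightarrow> int" where
  "prefix_sign w q = (- 1) ^ non_max_count 0 (take q w)"

definition stat_sign :: "nat list \<Rightarrow> int" where
  "stat_sign w = (- 1) ^ non_max_inv 0 w"

context
  fixes a :: nat and w :: "nat list"
  assumes a_pos: "0 < a" and a_min: "\<And>x. x \<in> set w \<Longrightarrow> a < x"
begin

lemma stat_sign_insert_at_0: "stat_sign (insert_at a 0 w) = stat_sign w"
  using a_pos a_min by (simp add: stat_sign_def insert_at_def non_max_inv_start)

lemma prefix_sign_insert_at_0: "prefix_sign (insert_at a 0 w) (Suc q) = prefix_sign w q"
proof -
  have "non_max_count a (take q w) = non_max_count 0 (take q w)"
    by (rule non_max_count_start) (meson a_min in_set_takeD)
  then show ?thesis using a_pos by (simp add: prefix_sign_def insert_at_def)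
qed

lemma stat_sign_insert_at:
  assumes "0 < p" "p \<le> length w"
  shows "stat_sign (insert_at a p w) = stat_sign w * prefix_sign w p"
proof -
  \<comment> \<open>As \<open>0 < p\<close>, the first letter \<open>x\<close> is read before
    \<open>a\<close> and exceeds it, so \<open>a\<close> is not a left-to-right maximum.\<close>
  from assms obtain x u where w: "w = x # u" by (cases w) auto
  from assms obtain k where p: "p = Suc k" by (cases p) auto
  have ax: "a < x" "\<And>y. y \<in> set u \<Longrightarrow> a < y" using a_min w by auto
  have "non_max_inv x (take k u @ a # drop k u) =
      non_max_inv x (take k u @ drop k u) + non_max_count x (take k u)"
    using ax by (intro non_max_inv_insert_min) (auto dest: in_set_takeD in_set_dropD)
  then show ?thesis
    using ax by (simp add: stat_sign_def prefix_sign_def insert_at_def w p power_add)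
qed

lemma prefix_sign_insert_at_before:
  assumes "q \<le> p" "p \<le> length w"
  shows "prefix_sign (insert_at a p w) q = prefix_sign w q"
  using assms by (simp add: prefix_sign_def insert_at_def min_def)

text \<open>The longer prefix also contains \<open>a\<close>, one more non-maximum, which flips the
  sign.\<close>

lemma prefix_sign_insert_at_after:
  assumes "0 < p" "p \<le> q" "p \<le> length w"
  shows "prefix_sign (insert_at a p w) (Suc q) = - prefix_sign w q"
proof -
  from assms obtain x u where w: "w = x # u" by (cases w) auto
  from assms obtain k where p: "p = Suc k" by (cases p) auto
  from assms p obtain d where q: "q = Suc (k + d)"
    by (metis add_Suc le_Suc_ex)
  have ax: "a < x" "\<And>y. y \<in> set u \<Longrightarrow> a < y" using a_min w by auto
  have "non_max_count x (take k u @ a # take d (drop k u)) =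
      Suc (non_max_count x (take k u @ take d (drop k u)))"
    using ax by (intro non_max_count_insert_min) (auto dest: in_set_takeD)
  moreover have "k \<le> length u" using assms w p by simp
  ultimately show ?thesis
    using ax
    by (simp add: prefix_sign_def insert_at_def w p q take_add min.absorb2 Suc_diff_le)
qed

end

lemma length_insert_at [simp]: "length (insert_at a p w) = Suc (length w)"
  by (simp add: insert_at_def)

section \<open>Sums of prefix signs\<close>

text \<open>The empty prefix is left out because insertion at the front follows a rule of its
  own.\<close>

definition prefix_sign_sum :: "nat list \<Rightarrow> int" where
  "prefix_sign_sum w = (\<Sum>q=1..length w. prefix_sign w q)"

text \<open>The summand \<open>1\<close> comes from the prefix consisting of \<open>a\<close>
  alone.\<close>

lemma prefix_sign_sum_insert_at_0:
  assumes "0 < a" "\<And>x. x \<in> set w \<Longrightarrow> a < x"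
  shows "prefix_sign_sum (insert_at a 0 w) = 1 + prefix_sign_sum w"
proof -
  have "prefix_sign_sum (insert_at a 0 w) = (\<Sum>q=0..length w. prefix_sign w q)"
    unfolding prefix_sign_sum_def length_insert_at One_nat_def sum.shift_bounds_cl_Suc_ivl
    by (simp add: prefix_sign_insert_at_0[OF assms])
  also have "\<dots> = prefix_sign w 0 + prefix_sign_sum w"
    unfolding prefix_sign_sum_def by (simp add: sum.atLeast_Suc_atMost)
  finally show ?thesis by (simp add: prefix_sign_def)
qed

text \<open>The index \<open>p\<close> occurs in both sums: the new prefixes ending just before and
  just after \<open>a\<close> both arise from the old prefix of length \<open>p\<close>, with
  opposite signs.\<close>

lemma prefix_sign_sum_insert_at:
  assumes "0 < a" "\<And>x. x \<in> set w \<Longrightarrow> a < x" "0 < p" "p \<le> length w"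
  shows "prefix_sign_sum (insert_at a p w) =
    (\<Sum>q=1..p. prefix_sign w q) - (\<Sum>q=p..length w. prefix_sign w q)"
proof -
  let ?s = "prefix_sign (insert_at a p w)"
  have "prefix_sign_sum (insert_at a p w) = (\<Sum>q=1..p. ?s q) + (\<Sum>q=Suc p..Suc (length w). ?s q)"
    unfolding prefix_sign_sum_def length_insert_at
    using sum.ub_add_nat[of 1 p ?s "Suc (length w) - p"] assms by simp
  also have "(\<Sum>q=Suc p..Suc (length w). ?s q) = (\<Sum>q=p..length w. - prefix_sign w q)"
    unfolding sum.shift_bounds_cl_Suc_ivl
    using assms by (intro sum.cong) (auto simp: prefix_sign_insert_at_after)
  also have "(\<Sum>q=1..p. ?s q) = (\<Sum>q=1..p. prefix_sign w q)"
    using assms by (intro sum.cong) (auto simp: prefix_sign_insert_at_before)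
  finally show ?thesis by (simp add: sum_negf)
qed

text \<open>Exchanging \<open>p\<close> and \<open>q\<close> maps one triangle onto the other; both
  contain the diagonal.\<close>

lemma sum_antisymmetric_triangles:
  fixes s :: "nat \<Rightarrow> int"
  shows "(\<Sum>p=1..n. s p * ((\<Sum>q=1..p. s q) - (\<Sum>q=p..n. s q))) = 0"
proof -
  have "(\<Sum>p=1..n. \<Sum>q=1..p. s p * s q) = (\<Sum>q=1..n. \<Sum>p=q..n. s p * s q)"
    unfolding sum.Sigma[OF finite_atLeastAtMost ballI[OF finite_atLeastAtMost]]
    by (rule sum.reindex_bij_witness[of _ "\<lambda>(q, p). (p, q)" "\<lambda>(p, q). (q, p)"]) auto
  also have "\<dots> = (\<Sum>p=1..n. \<Sum>q=p..n. s p * s q)" by (simp add: mult.commute)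
  finally show ?thesis by (simp add: right_diff_distrib sum_subtractf sum_distrib_left)
qed

section \<open>Signed sums over permutations\<close>

text \<open>Insertion is bijective: its inverse deletes \<open>a\<close> and records how many
  letters preceded it.\<close>

lemma sum_permutations_of_set_insert:
  assumes "finite A" "a \<notin> A"
  shows "(\<Sum>w\<in>permutations_of_set (insert a A). h w) =
    (\<Sum>w\<in>permutations_of_set A. \<Sum>p\<le>card A. h (insert_at a p w))"
proof -
  have "(\<Sum>w\<in>permutations_of_set (insert a A). h w) =
      (\<Sum>(w, p)\<in>permutations_of_set A \<times> {..card A}. h (insert_at a p w))"
  proof (rule sum.reindex_bij_witness[of _ "\<lambda>(w, p). insert_at a p w"
        "\<lambda>w. (remove1 a w, length (takeWhile (\<lambda>x. x \<noteq> a) w))"])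
    fix w assume "w \<in> permutations_of_set (insert a A)"
    then have w: "set w = insert a A" "distinct w"
      by (auto simp: permutations_of_set_def)
    then obtain u v where uv: "w = u @ a # v" "a \<notin> set u"
      by (metis insertI1 split_list_first)
    with w have v: "a \<notin> set v" by simp
    have tw: "takeWhile (\<lambda>x. x \<noteq> a) w = u"
      using uv by (simp add: takeWhile_tail) (metis takeWhile_eq_all_conv)
    have rm: "remove1 a w = u @ v" using uv by (simp add: remove1_append)
    have uvA: "set (u @ v) = A" "distinct (u @ v)"
      using w uv v assms by auto
    then have "card A = length (u @ v)" using distinct_card by metis
    then show "(remove1 a w, length (takeWhile (\<lambda>x. x \<noteq> a) w)) \<in> permutations_of_set A \<times> {..card A}"
      using uvA unfolding tw rm by (simp add: permutations_of_set_def)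
    show "(case (remove1 a w, length (takeWhile (\<lambda>x. x \<noteq> a) w)) of (w, p) \<Rightarrow> insert_at a p w) = w"
      unfolding tw rm by (simp add: insert_at_def uv)
    then show "(case (remove1 a w, length (takeWhile (\<lambda>x. x \<noteq> a) w)) of
        (w, p) \<Rightarrow> h (insert_at a p w)) = h w" by simp
  next
    fix y assume "y \<in> permutations_of_set A \<times> {..card A}"
    then obtain w p where y: "y = (w, p)" and w: "set w = A" "distinct w" and p: "p \<le> card A"
      by (auto simp: permutations_of_set_def)
    have len: "p \<le> length w" using w p distinct_card by metis
    have nt: "a \<notin> set (take p w)" "a \<notin> set (drop p w)"
      using w assms by (auto dest: in_set_takeD in_set_dropD)
    have "takeWhile (\<lambda>x. x \<noteq> a) (insert_at a p w) = take p w"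
      unfolding insert_at_def using nt
      by (simp add: takeWhile_tail) (metis takeWhile_eq_all_conv)
    moreover have "remove1 a (insert_at a p w) = w"
      using nt by (simp add: insert_at_def remove1_append)
    ultimately show "(remove1 a (case y of (w, p) \<Rightarrow> insert_at a p w),
        length (takeWhile (\<lambda>x. x \<noteq> a) (case y of (w, p) \<Rightarrow> insert_at a p w))) = y"
      using y len by simp
    have "set (insert_at a p w) = insert a (set (take p w @ drop p w))"
      unfolding insert_at_def set_append by simp
    moreover have "distinct (take p w @ drop p w)" using w by simp
    then have "distinct (insert_at a p w)"
      unfolding insert_at_def using nt by (simp only: distinct_append) auto
    ultimately show "(case y of (w, p) \<Rightarrow> insert_at a p w) \<in> permutations_of_set (insert a A)"
      using y w by (simp add: permutations_of_set_def)
  qed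
  then show ?thesis by (simp add: sum.cartesian_product)
qed

text \<open>Both identities hold for each \<open>w\<close> separately. In the first, the front gives
  the \<open>1\<close> and the other places give the prefix signs; in the second, only the front
  survives, the rest cancelling by antisymmetry.\<close>

lemma sum_insert_at_min:
  assumes "finite A" "0 < a" "\<And>x. x \<in> A \<Longrightarrow> a < x"
  shows "(\<Sum>w\<in>permutations_of_set (insert a A). stat_sign w) =
      (\<Sum>w\<in>permutations_of_set A. stat_sign w * (1 + prefix_sign_sum w))" (is ?A)
    and "(\<Sum>w\<in>permutations_of_set (insert a A). stat_sign w * prefix_sign_sum w) =
      (\<Sum>w\<in>permutations_of_set A. stat_sign w * (1 + prefix_sign_sum w))" (is ?B)
proof -
  have a: "a \<notin> A" using assms by blast
  have split: "(\<Sum>p\<le>card A. f p) = f 0 + (\<Sum>p=1..card A. f p)" for f :: "nat \<Rightarrow> int"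
    by (simp add: atMost_atLeast0 sum.atLeast_Suc_atMost)
  have "(\<Sum>p\<le>card A. stat_sign (insert_at a p w)) = stat_sign w * (1 + prefix_sign_sum w)"
    and "(\<Sum>p\<le>card A. stat_sign (insert_at a p w) * prefix_sign_sum (insert_at a p w)) =
      stat_sign w * (1 + prefix_sign_sum w)"
    if w: "w \<in> permutations_of_set A" for w
  proof -
    have min: "\<And>x. x \<in> set w \<Longrightarrow> a < x" and len: "length w = card A"
      using w assms by (auto simp: permutations_of_set_def distinct_card)
    have sgn: "stat_sign (insert_at a p w) = stat_sign w * prefix_sign w p"
      if "p \<in> {1..card A}" for p
      using that len by (intro stat_sign_insert_at assms(2) min) auto
    show "(\<Sum>p\<le>card A. stat_sign (insert_at a p w)) = stat_sign w * (1 + prefix_sign_sum w)"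
      unfolding split
      by (simp add: sgn stat_sign_insert_at_0[OF assms(2) min] prefix_sign_sum_def len
          distrib_left sum_distrib_left)
    have "(\<Sum>p=1..card A. stat_sign (insert_at a p w) * prefix_sign_sum (insert_at a p w)) =
        (\<Sum>p=1..card A. stat_sign w * (prefix_sign w p *
          ((\<Sum>q=1..p. prefix_sign w q) - (\<Sum>q=p..card A. prefix_sign w q))))"
      using len
      by (intro sum.cong refl) (simp add: sgn prefix_sign_sum_insert_at[OF assms(2) min])
    also have "\<dots> = 0"
      unfolding sum_distrib_left[symmetric] sum_antisymmetric_triangles by simp
    finally show "(\<Sum>p\<le>card A. stat_sign (insert_at a p w) * prefix_sign_sum (insert_at a p w)) =
        stat_sign w * (1 + prefix_sign_sum w)"
      unfolding split
      by (simp add: stat_sign_insert_at_0[OF assms(2) min]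
          prefix_sign_sum_insert_at_0[OF assms(2) min])
  qed
  then show ?A ?B
    unfolding sum_permutations_of_set_insert[OF assms(1) a] by simp_all
qed

lemma signed_sums_eq_power:
  assumes "finite A" "A \<noteq> {}" "\<And>x. x \<in> A \<Longrightarrow> 0 < x"
  shows "(\<Sum>w\<in>permutations_of_set A. stat_sign w) = 2 ^ (card A - 1) \<and>
    (\<Sum>w\<in>permutations_of_set A. stat_sign w * prefix_sign_sum w) = 2 ^ (card A - 1)"
  using assms
\<comment> \<open>This induction always adds an element below all of \<open>A\<close>, as inserting
  a new minimum requires.\<close>
proof (induction A rule: finite_linorder_min_induct)
  case (insert a A)
  have step: "(\<Sum>w\<in>permutations_of_set A. stat_sign w * (1 + prefix_sign_sum w)) = 2 ^ card A"
  \<comment> \<open>The induction hypothesis excludes the empty set, where the second sum is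
    \<open>0\<close>; there the empty word alone gives \<open>1 = 2 ^ 0\<close>.\<close>
  proof (cases "A = {}")
    case True
    then show ?thesis by (simp add: stat_sign_def prefix_sign_sum_def)
  next
    case False
    then have "card A = Suc (card A - 1)" using insert.hyps by (simp add: card_gt_0_iff)
    then have "(2 :: int) ^ card A = 2 ^ (card A - 1) + 2 ^ (card A - 1)"
      by (metis mult_2 power_Suc)
    then show ?thesis
      using insert.IH[OF False] insert.prems by (simp add: distrib_left sum.distrib)
  qed
  have "0 < a" "\<And>x. x \<in> A \<Longrightarrow> a < x" "a \<notin> A" using insert by auto
  then show ?case
    using sum_insert_at_min[OF insert.hyps(1), of a] step insert.hyps(1) by simp
qed simp

section \<open>Values of the generating polynomial at 1 and -1\<close>

theorem theorem3p13:
  shows "stat_exhibits_CSP Stat123 (\<lambda>n. if n = 0 then 1 else 2 ^ (n - 1))"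
proof -
  have one: "poly (generating_poly Stat123 n) 1 = int (card (Sym n))" for n
    by (simp add: generating_poly_def poly_sum poly_monom)
  have "poly (generating_poly Stat123 n) (- 1) = (\<Sum>w\<in>Sym n. stat_sign w)" for n
    unfolding generating_poly_def poly_sum stat_sign_def
    by (intro sum.cong refl) (subst Stat123_eq_non_max_inv, auto simp: poly_monom permutations_of_set_def)
  moreover have "(\<Sum>w\<in>Sym n. stat_sign w) = (if n = 0 then 1 else 2 ^ (n - 1))" for n
    using signed_sums_eq_power[of "{1..n}"] by (auto simp: stat_sign_def)
  \<comment> \<open>The involution enters only through its number of fixed points, which is
    prescribed to be the value at -1.\<close>
  ultimately show ?thesis
    by (auto simp: stat_exhibits_CSP_def exhibits_CSP_def one)
qed

end
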